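(* Let $1\le s\le r\le 2$ and $0<\kappa<1$. Then there exists a constant $C=C(r,s)>0$ such that for all $n\ge m$, $$\widehat{\boldsymbol{\lambda}}\big(\mathcal{P}_m(\ell_{r,s}^n)\big)\le C^m\Big(\frac nm\Big)^{\frac m{r'}}\max\Big\{1,\frac{(\log m)^{m(\frac1s-\frac1r)}}{n^{\frac{m^\kappa}{2r'}}}\Big\}.$$
   Context: $r'$ is the conjugate exponent of $r$. $\ell_{r,s}^n$ is $\mathbb{C}^n$ with Lorentz norm $\|z\|_{\ell_{r,s}}=\|(z_k^*k^{1/r-1/s})_k\|_{\ell_s}$. $\mathcal{P}_m(X_n)$ is the space of $m$-homogeneous polynomials $\sum_{\alpha\in\mathbb{N}_0^n,|\alpha|=m}c_\alpha z^\alpha$ on $\mathbb{C}^n$ with sup norm over the open unit ball $B_{X_n}$. For $\alpha\in\mathbb{N}_0^n$, $c_{X_n}(\alpha)=1/\sup_{z\in B_{X_n}}|z^\alpha|$, and for an index set $J$ the polynomial projection constant is $\widehat{\boldsymbol{\lambda}}(\mathcal{P}_J(X_n))=\sup_{z\in B_{X_n}}\sum_{\alpha\in J}c_{X_n}(\alpha)|z^\alpha|$; here $J=\{\alpha\in\mathbb{N}_0^n:|\alpha|=m\}$. *)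

theory Defs
  imports "HOL-Analysis.Analysis"
begin

text \<open>Vectors in C^n are represented as functions nat => complex, only the
coordinates 0..n-1 being relevant (the others are required to vanish).\<close>

definition decr_rearr :: "nat \<Rightarrow> (nat \<Rightarrow> complex) \<Rightarrow> real list" where
  "decr_rearr n z = rev (sort (map (\<lambda>k. cmod (z k)) [0..<n]))"

definition lorentz_norm :: "real \<Rightarrow> real \<Rightarrow> nat \<Rightarrow> (nat \<Rightarrow> complex) \<Rightarrow> real" where
  "lorentz_norm r s n z =
     (\<Sum>k<n. (decr_rearr n z ! k * real (Suc k) powr (1/r - 1/s)) powr s) powr (1/s)"

definition lorentz_ball :: "real \<Rightarrow> real \<Rightarrow> nat \<Rightarrow> (nat \<Rightarrow> complex) set" where
  "lorentz_ball r s n = {z. (\<forall>k\<ge>n. z k = 0) \<and> lorentz_norm r s n z < 1}"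

definition multi_idx :: "nat \<Rightarrow> nat \<Rightarrow> (nat \<Rightarrow> nat) set" where
  "multi_idx n m = {\<alpha>. (\<forall>k\<ge>n. \<alpha> k = 0) \<and> (\<Sum>k<n. \<alpha> k) = m}"

definition monom_val :: "nat \<Rightarrow> (nat \<Rightarrow> nat) \<Rightarrow> (nat \<Rightarrow> complex) \<Rightarrow> complex" where
  "monom_val n \<alpha> z = (\<Prod>k<n. z k ^ \<alpha> k)"

definition c_coeff :: "real \<Rightarrow> real \<Rightarrow> nat \<Rightarrow> (nat \<Rightarrow> nat) \<Rightarrow> real" where
  "c_coeff r s n \<alpha> = 1 / (SUP z\<in>lorentz_ball r s n. cmod (monom_val n \<alpha> z))"

definition poly_proj_const :: "real \<Rightarrow> real \<Rightarrow> nat \<Rightarrow> nat \<Rightarrow> real" where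
  "poly_proj_const r s n m =
     (SUP z\<in>lorentz_ball r s n. \<Sum>\<alpha>\<in>multi_idx n m. c_coeff r s n \<alpha> * cmod (monom_val n \<alpha> z))"

end

theory Submission
  imports Defs
begin

text \<open>
  Given a multi-index \<open>\<alpha>\<close> of degree \<open>m\<close> and a point \<open>z\<close> of the ball, the vector
  \<open>w = max \<bar>z\<bar> (m powr (-1/r))\<close> on the support of \<open>\<alpha>\<close>, \<open>w = \<bar>z\<bar>\<close> elsewhere, has Lorentz norm at
  most a constant \<open>A\<close>, because the support has at most \<open>m\<close> elements. Testing
  \<open>sup \<bar>w\<^sup>\<alpha>\<bar>\<close> with \<open>w / A\<close> gives \<open>c(\<alpha>) \<bar>z\<^sup>\<alpha>\<bar> \<le> A\<^sup>m y\<^sup>\<alpha>\<close>, where \<open>y = min 1 (m powr (1/r) \<bar>z\<bar>)\<close> does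
  not depend on \<open>\<alpha>\<close>. The sum of all \<open>y\<^sup>\<alpha>\<close> is a complete homogeneous symmetric polynomial; as
  \<open>y \<le> 1\<close>, its generating function at \<open>t \<le> 1/2\<close> is at most \<open>exp (2 t (\<Sum>y))\<close>. Since
  \<open>\<Sum>y \<le> 2 m L\<close> with \<open>L = (n/m) powr (1 - 1/r)\<close>, the choice \<open>t = 1/(2L)\<close> yields the bound
  \<open>C\<^sup>m L\<^sup>m\<close>; of the maximum, only the term \<open>1\<close> is used.
\<close>

section \<open>Rearrangement inequality and decreasing rearrangements\<close>

lemma rearrangement_inequality:
  fixes f g :: "nat \<Rightarrow> real"
  assumes "p permutes {..<n}"
    and "\<And>i j. i \<le> j \<Longrightarrow> j < n \<Longrightarrow> f j \<le> f i"
    and "\<And>i j. i \<le> j \<Longrightarrow> j < n \<Longrightarrow> g j \<le> g i"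
  shows "(\<Sum>k<n. f (p k) * g k) \<le> (\<Sum>k<n. f k * g k)"
  using assms
proof (induction n arbitrary: p)
  case 0
  then show ?case by simp
next
  case (Suc n)
  \<comment> \<open>\<open>q\<close> fixes \<open>n\<close> and differs from \<open>p\<close> only
    at \<open>n\<close> and at the \<open>j\<close> with \<open>p j = n\<close>, where the two
    values are exchanged.\<close>
  define q where "q = Transposition.transpose n (p n) \<circ> p"
  have pn: "p n \<in> {..<Suc n}"
    using permutes_in_image[OF Suc.prems(1), of n] by simp
  have qS: "q permutes {..<Suc n}"
    unfolding q_def by (intro permutes_compose[OF Suc.prems(1)] permutes_swap_id) (use pn in auto)
  have qn: "q n = n"
    by (simp add: q_def)
  have q: "q permutes {..<n}"
    by (rule permutes_superset[OF qS]) (use qn in \<open>auto simp: less_Suc_eq\<close>)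
  have IH: "(\<Sum>k<n. f (q k) * g k) \<le> (\<Sum>k<n. f k * g k)"
    by (rule Suc.IH[OF q]) (use Suc.prems(2,3) in auto)
  have inj: "p i = p j \<longleftrightarrow> i = j" for i j
    using permutes_inj[OF Suc.prems(1)] by (auto dest: injD)
  have "(\<Sum>k<Suc n. f (p k) * g k) \<le> (\<Sum>k<Suc n. f (q k) * g k)"
  proof (cases "p n = n")
    case True
    then show ?thesis by (simp add: q_def)
  next
    case False
    obtain j where j: "p j = n" "j < Suc n"
      using permutes_image[OF Suc.prems(1)] by (metis imageE lessI lessThan_iff)
    with False have jn: "j < n" using less_Suc_eq by auto
    have eq: "q k = p k" if "k \<in> {..<n} - {j}" for k
      using that inj[of k j] inj[of k n] j(1) by (auto simp: q_def Transposition.transpose_def)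
    have qj: "q j = p n" using j(1) by (simp add: q_def)
    have split: "(\<Sum>k<Suc n. f (u k) * g k)
        = f (u n) * g n + f (u j) * g j + (\<Sum>k\<in>{..<n} - {j}. f (u k) * g k)" for u
      using sum.remove[of "{..<n}" j "\<lambda>k. f (u k) * g k"] jn by simp
    \<comment> \<open>This product is exactly the gain of the \<open>q\<close>-sum over the
      \<open>p\<close>-sum.\<close>
    have "0 \<le> (f (p n) - f n) * (g j - g n)"
      using Suc.prems(2)[of "p n" n] Suc.prems(3)[of j n] pn jn by simp
    then show ?thesis
      unfolding split[of p] split[of q] using eq by (simp add: qj qn j(1) algebra_simps)
  qed
  also have "\<dots> \<le> (\<Sum>k<Suc n. f k * g k)"
    using IH by (simp add: qn)
  finally show ?case .
qed

lemma length_decr_rearr [simp]: "length (decr_rearr n z) = n"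
  by (simp add: decr_rearr_def)

lemma decr_rearr_permutation:
  obtains p where "p permutes {..<n}" "\<And>k. k < n \<Longrightarrow> decr_rearr n z ! k = cmod (z (p k))"
proof -
  have "mset (decr_rearr n z) = mset (map (\<lambda>k. cmod (z k)) [0..<n])"
    by (simp add: decr_rearr_def)
  then obtain p where p: "p permutes {..<length (map (\<lambda>k. cmod (z k)) [0..<n])}"
    "permute_list p (map (\<lambda>k. cmod (z k)) [0..<n]) = decr_rearr n z"
    by (rule mset_eq_permutation)
  have "decr_rearr n z ! k = cmod (z (p k))" if "k < n" for k
    using permute_list_nth[OF p(1), of k] that permutes_in_image[OF p(1), of k] p(2) by auto
  with p(1) show ?thesis by (intro that[of p]) auto
qed

lemma decr_rearr_antimono: "i \<le> j \<Longrightarrow> j < n \<Longrightarrow> decr_rearr n z ! j \<le> decr_rearr n z ! i"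
  using sorted_rev_nth_mono[of "decr_rearr n z" i j] by (simp add: decr_rearr_def)

lemma decr_rearr_nonneg: "k < n \<Longrightarrow> 0 \<le> decr_rearr n z ! k"
  by (metis decr_rearr_permutation norm_ge_zero)

section \<open>The Lorentz norm as a weighted power sum\<close>

text \<open>For \<open>1 \<le> s\<close> this is the \<open>s\<close>-th power of the Lorentz norm,
  as \<open>s * (1/r - 1/s) = s/r - 1\<close>. Without the outer root, estimates can be made term by
  term.\<close>

definition lorentz_sum :: "real \<Rightarrow> real \<Rightarrow> nat \<Rightarrow> (nat \<Rightarrow> complex) \<Rightarrow> real" where
  "lorentz_sum r s n z = (\<Sum>k<n. (decr_rearr n z ! k) powr s * real (Suc k) powr (s/r - 1))"

lemma lorentz_norm_less_1_iff:
  assumes "1 \<le> s"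
  shows "lorentz_norm r s n z < 1 \<longleftrightarrow> lorentz_sum r s n z < 1"
proof -
  have "(decr_rearr n z ! k * real (Suc k) powr (1/r - 1/s)) powr s
      = (decr_rearr n z ! k) powr s * real (Suc k) powr (s/r - 1)" if "k < n" for k
    using decr_rearr_nonneg[OF that, of z] assms
    by (simp add: powr_mult powr_powr left_diff_distrib)
  then have eq: "lorentz_norm r s n z = lorentz_sum r s n z powr (1/s)"
    unfolding lorentz_norm_def lorentz_sum_def
    by (intro arg_cong[where f="\<lambda>x. x powr (1/s)"] sum.cong) auto
  have nn: "0 \<le> lorentz_sum r s n z"
    unfolding lorentz_sum_def by (intro sum_nonneg) simp
  show ?thesis
  proof
    assume "lorentz_norm r s n z < 1"
    then show "lorentz_sum r s n z < 1"
      using ge_one_powr_ge_zero[of "lorentz_sum r s n z" "1/s"] assms eq by fastforce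
  next
    assume "lorentz_sum r s n z < 1"
    then show "lorentz_norm r s n z < 1"
      using powr_less_mono2[of "1/s" "lorentz_sum r s n z" 1] assms nn eq by simp
  qed
qed

text \<open>For \<open>s \<le> r\<close> the weights are nonincreasing, so the decreasing order of
  the moduli maximises the weighted sum. This allows \<open>z\<close> to be summed in an order
  adapted to another vector.\<close>

lemma permuted_sum_le_lorentz_sum:
  assumes "0 < s" "s \<le> r" "p permutes {..<n}"
  shows "(\<Sum>k<n. cmod (z (p k)) powr s * real (Suc k) powr (s/r - 1)) \<le> lorentz_sum r s n z"
proof -
  obtain q where q: "q permutes {..<n}" "\<And>k. k < n \<Longrightarrow> decr_rearr n z ! k = cmod (z (q k))"
    using decr_rearr_permutation by blast
  define u where "u = inv q \<circ> p"
  have u: "u permutes {..<n}"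
    unfolding u_def by (intro permutes_compose assms permutes_inv q)
  have "cmod (z (p k)) = decr_rearr n z ! u k" if "k < n" for k
    using q(2)[of "u k"] permutes_in_image[OF u, of k] that permutes_inverses(1)[OF q(1)]
    by (simp add: u_def)
  then have "(\<Sum>k<n. cmod (z (p k)) powr s * real (Suc k) powr (s/r - 1))
      = (\<Sum>k<n. (decr_rearr n z ! u k) powr s * real (Suc k) powr (s/r - 1))"
    by (intro sum.cong) auto
  also have "\<dots> \<le> lorentz_sum r s n z"
    unfolding lorentz_sum_def using assms
    by (intro rearrangement_inequality[OF u] powr_mono2 powr_mono2' decr_rearr_antimono
        decr_rearr_nonneg) auto
  finally show ?thesis .
qed

lemma sum_powr_le:
  fixes \<theta> :: real
  assumes "0 < \<theta>" "\<theta> \<le> 1"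
  shows "(\<Sum>k<m. real (Suc k) powr (\<theta> - 1)) \<le> real m powr \<theta> / \<theta>"
proof (induction m)
  case 0
  then show ?case by simp
next
  case (Suc m)
  \<comment> \<open>Comparison with the integral of \<open>x powr (\<theta> - 1)\<close> over one
    unit interval; these increments telescope. The interval at 0 is treated apart, since the
    derivative formula needs a positive argument.\<close>
  have "real (Suc m) powr (\<theta> - 1) \<le> (real (Suc m) powr \<theta> - real m powr \<theta>) / \<theta>"
  proof (cases "m = 0")
    case True
    then show ?thesis using assms by (simp add: field_simps)
  next
    case False
    have "\<exists>z>real m. z < real (Suc m) \<and>
        real (Suc m) powr \<theta> - real m powr \<theta> = (real (Suc m) - real m) * (\<theta> * z powr (\<theta> - 1))"
      using False by (intro MVT2) (auto intro!: has_real_derivative_powr)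
    then obtain z where z: "real m < z" "z < real (Suc m)"
      "real (Suc m) powr \<theta> - real m powr \<theta> = \<theta> * z powr (\<theta> - 1)" by auto
    have "real (Suc m) powr (\<theta> - 1) \<le> z powr (\<theta> - 1)"
      using z assms by (intro powr_mono2') auto
    then show ?thesis using z(3) assms by simp
  qed
  with Suc.IH show ?case by (simp add: diff_divide_distrib)
qed

text \<open>Positions below \<open>m\<close> are covered by the initial sum, which gives
  \<open>1/\<theta>\<close>; the at most \<open>m\<close> others have weight at most
  \<open>m powr (\<theta> - 1)\<close> each, which gives the \<open>1\<close>.\<close>

lemma sum_weights_subset_le:
  fixes \<theta> :: real
  assumes "0 < \<theta>" "\<theta> \<le> 1" "finite A" "card A \<le> m"
  shows "(\<Sum>k\<in>A. real (Suc k) powr (\<theta> - 1)) \<le> (1 + 1/\<theta>) * real m powr \<theta>"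
proof -
  have "(\<Sum>k\<in>A. real (Suc k) powr (\<theta> - 1))
      = (\<Sum>k\<in>A \<inter> {..<m}. real (Suc k) powr (\<theta> - 1)) + (\<Sum>k\<in>A - {..<m}. real (Suc k) powr (\<theta> - 1))"
    using assms(3) by (rule sum.Int_Diff)
  moreover have "(\<Sum>k\<in>A \<inter> {..<m}. real (Suc k) powr (\<theta> - 1)) \<le> real m powr \<theta> / \<theta>"
    using sum_mono2[of "{..<m}" "A \<inter> {..<m}" "\<lambda>k. real (Suc k) powr (\<theta> - 1)"]
      sum_powr_le[OF assms(1,2), of m] by force
  moreover have "(\<Sum>k\<in>A - {..<m}. real (Suc k) powr (\<theta> - 1)) \<le> real m powr \<theta>"
  proof (cases "m = 0")
    case True
    then show ?thesis using assms by auto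
  next
    case False
    have "(\<Sum>k\<in>A - {..<m}. real (Suc k) powr (\<theta> - 1)) \<le> of_nat (card (A - {..<m})) * real m powr (\<theta> - 1)"
      using assms False by (intro sum_bounded_above powr_mono2') auto
    also have "\<dots> \<le> real m * real m powr (\<theta> - 1)"
      using assms card_mono[of A "A - {..<m}"] by (intro mult_right_mono) auto
    also have "\<dots> = real m powr \<theta>"
      using False by (simp add: powr_diff)
    finally show ?thesis .
  qed
  ultimately show ?thesis by (simp add: algebra_simps)
qed

text \<open>Replacing each weight by the lower bound \<open>n powr (s/r - 1)\<close> controls the
  plain sum of \<open>s\<close>-th powers, and hence the sum of moduli.\<close>

lemma sum_cmod_le:
  assumes "1 \<le> s" "s \<le> r" "lorentz_sum r s n z < 1"
  shows "(\<Sum>k<n. cmod (z k)) \<le> 2 * real n powr (1 - 1/r)"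
proof (cases "n = 0")
  case True
  then show ?thesis by simp
next
  case False
  have "(\<Sum>k<n. cmod (z k) powr s) * real n powr (s/r - 1)
      \<le> (\<Sum>k<n. cmod (z k) powr s * real (Suc k) powr (s/r - 1))"
    unfolding sum_distrib_right using assms by (intro sum_mono mult_left_mono powr_mono2') auto
  also have "\<dots> \<le> lorentz_sum r s n z"
    using permuted_sum_le_lorentz_sum[OF _ assms(2) permutes_id, where n=n and z=z] assms by simp
  finally have le: "(\<Sum>k<n. cmod (z k) powr s) * real n powr (s/r - 1) \<le> 1"
    using assms by simp
  have "(\<Sum>k<n. cmod (z k)) * real n powr (1/r) = (\<Sum>k<n. cmod (z k) * real n powr (1/r))"
    by (rule sum_distrib_right)
  also have "\<dots> \<le> (\<Sum>k<n. cmod (z k) powr s * real n powr (s/r) + 1)"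
  proof (rule sum_mono)
    fix k
    define x where "x = cmod (z k) * real n powr (1/r)"
    have x0: "0 \<le> x" by (simp add: x_def)
    \<comment> \<open>A substitute for Hoelder's inequality: after scaling by
      \<open>n powr (1/r)\<close>, each summand contributes at most \<open>n\<close> in total,
      whence the constant 2.\<close>
    have "x \<le> x powr s + 1"
    proof (cases "x \<le> 1")
      case False
      then show ?thesis using powr_mono[OF assms(1), of x] by simp
    qed (simp add: add_increasing)
    also have "x powr s = cmod (z k) powr s * real n powr (s/r)"
      by (simp add: x_def powr_mult powr_powr)
    finally show "cmod (z k) * real n powr (1/r) \<le> cmod (z k) powr s * real n powr (s/r) + 1"
      by (simp add: x_def)
  qed
  also have "\<dots> = real n * ((\<Sum>k<n. cmod (z k) powr s) * real n powr (s/r - 1)) + real n"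
    using False by (simp add: sum.distrib sum_distrib_right powr_diff)
  also have "\<dots> \<le> real n * 1 + real n"
    by (intro add_right_mono mult_left_mono le) auto
  finally have "(\<Sum>k<n. cmod (z k)) * real n powr (1/r) \<le> 2 * real n" by simp
  then show ?thesis
    using False by (simp add: powr_diff field_simps)
qed

section \<open>Complete homogeneous symmetric sums\<close>

text \<open>The left side is the coefficient of \<open>t ^ m\<close> in the product of the series
  \<open>1 / (1 - t * y k)\<close>. All coefficients are nonnegative, so it is at most the value at
  \<open>t\<close> divided by \<open>t ^ m\<close>.\<close>

lemma sum_multi_idx_le:
  fixes y :: "nat \<Rightarrow> real"
  assumes y: "\<And>k. k < n \<Longrightarrow> 0 \<le> y k \<and> y k \<le> 1" and t: "0 < t" "t \<le> 1/2"
  shows "(\<Sum>\<alpha>\<in>multi_idx n m. \<Prod>k<n. y k ^ \<alpha> k) \<le> exp (2 * t * (\<Sum>k<n. y k)) / t ^ m"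
proof -
  \<comment> \<open>Multi-indices are 0 outside \<open>{..<n}\<close>, elements of
    \<open>Pi\<^sub>E\<close> are \<open>undefined\<close> there; \<open>?R\<close> translates.
    Entries are at most \<open>m\<close>, so geometric sums up to \<open>m\<close> suffice.\<close>
  let ?R = "\<lambda>\<alpha>. restrict \<alpha> {..<n}"
  have inj: "inj_on ?R (multi_idx n m)"
  proof (rule inj_onI, rule ext)
    fix \<alpha> \<beta> :: "nat \<Rightarrow> nat" and k
    assume "\<alpha> \<in> multi_idx n m" "\<beta> \<in> multi_idx n m" "?R \<alpha> = ?R \<beta>"
    then show "\<alpha> k = \<beta> k"
      by (cases "k < n") (auto simp: multi_idx_def dest: fun_cong[where x=k])
  qed
  have sub: "?R ` multi_idx n m \<subseteq> Pi\<^sub>E {..<n} (\<lambda>_. {..m})"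
  proof (intro image_subsetI PiE_I)
    fix \<alpha> k assume "\<alpha> \<in> multi_idx n m" "k \<in> {..<n}"
    then show "?R \<alpha> k \<in> {..m}"
      using member_le_sum[of k "{..<n}" \<alpha>] by (auto simp: multi_idx_def)
  qed auto
  have geometric: "(\<Sum>a\<le>m. (t * y k) ^ a) \<le> exp (2 * t * y k)" if "k < n" for k
  proof -
    define x where "x = t * y k"
    have x: "0 \<le> x" "x \<le> 1/2"
      using y[OF that] t mult_mono[of t "1/2" "y k" 1] by (auto simp: x_def)
    have "(\<Sum>a\<le>m. x ^ a) \<le> 1 / (1 - x)"
      using x by (subst sum_gp0) (auto intro!: divide_right_mono)
    also have "\<dots> \<le> 1 + 2 * x"
    proof -
      have "0 \<le> x * (1 - 2 * x)" using x by simp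
      then show ?thesis using x by (simp add: field_simps)
    qed
    also have "\<dots> \<le> exp (2 * x)" by (rule exp_ge_add_one_self)
    finally show ?thesis by (simp add: x_def mult.assoc)
  qed
  have "t ^ m * (\<Sum>\<alpha>\<in>multi_idx n m. \<Prod>k<n. y k ^ \<alpha> k)
      = (\<Sum>\<alpha>\<in>multi_idx n m. \<Prod>k<n. (t * y k) ^ (?R \<alpha> k))"
    unfolding sum_distrib_left
  proof (rule sum.cong)
    fix \<alpha> assume "\<alpha> \<in> multi_idx n m"
    then have "t ^ m = (\<Prod>k<n. t ^ \<alpha> k)" by (simp add: multi_idx_def power_sum[symmetric])
    then show "t ^ m * (\<Prod>k<n. y k ^ \<alpha> k) = (\<Prod>k<n. (t * y k) ^ (?R \<alpha> k))"
      by (simp add: power_mult_distrib prod.distrib)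
  qed simp
  also have "\<dots> = (\<Sum>\<beta>\<in>?R ` multi_idx n m. \<Prod>k<n. (t * y k) ^ \<beta> k)"
    by (subst sum.reindex[OF inj]) simp
  also have "\<dots> \<le> (\<Sum>\<beta>\<in>Pi\<^sub>E {..<n} (\<lambda>_. {..m}). \<Prod>k<n. (t * y k) ^ \<beta> k)"
    using y t by (intro sum_mono2 sub finite_PiE prod_nonneg) auto
  also have "\<dots> = (\<Prod>k<n. \<Sum>a\<le>m. (t * y k) ^ a)"
    by (rule prod_sum_PiE[symmetric]) auto
  also have "\<dots> \<le> (\<Prod>k<n. exp (2 * t * y k))"
    using y t geometric by (intro prod_mono) (auto intro!: sum_nonneg)
  also have "\<dots> = exp (2 * t * (\<Sum>k<n. y k))"
    by (simp add: exp_sum sum_distrib_left)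
  finally show ?thesis using t by (simp add: field_simps)
qed

section \<open>Coefficient bounds by test vectors\<close>

text \<open>Ensures that the real supremum in \<open>c_coeff\<close> really dominates the values on
  the ball.\<close>

lemma bdd_above_monom_val:
  assumes "1 \<le> s" "s \<le> r"
  shows "bdd_above ((\<lambda>z. cmod (monom_val n \<alpha> z)) ` lorentz_ball r s n)"
proof (rule bdd_aboveI2)
  fix z assume "z \<in> lorentz_ball r s n"
  then have "lorentz_sum r s n z < 1"
    using lorentz_norm_less_1_iff[OF assms(1)] by (simp add: lorentz_ball_def)
  then have "(\<Sum>k<n. cmod (z k)) \<le> 2 * real n powr (1 - 1/r)"
    by (rule sum_cmod_le[OF assms])
  then have "cmod (z k) \<le> 2 * real n powr (1 - 1/r)" if "k < n" for k
    using member_le_sum[of k "{..<n}" "\<lambda>k. cmod (z k)"] that by force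
  then show "cmod (monom_val n \<alpha> z) \<le> (\<Prod>k<n. (2 * real n powr (1 - 1/r)) ^ \<alpha> k)"
    unfolding monom_val_def prod_norm[symmetric] norm_power
    by (intro prod_mono conjI power_mono) auto
qed

lemma c_coeff_times_monom_le:
  assumes "w \<in> lorentz_ball r s n" "1 \<le> s" "s \<le> r" "monom_val n \<alpha> w \<noteq> 0"
  shows "c_coeff r s n \<alpha> * cmod (monom_val n \<alpha> z) \<le> cmod (monom_val n \<alpha> z) / cmod (monom_val n \<alpha> w)"
proof -
  have "cmod (monom_val n \<alpha> w) \<le> (SUP z\<in>lorentz_ball r s n. cmod (monom_val n \<alpha> z))"
    by (rule cSUP_upper[OF assms(1) bdd_above_monom_val[OF assms(2,3)]])
  then have "c_coeff r s n \<alpha> \<le> 1 / cmod (monom_val n \<alpha> w)"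
    unfolding c_coeff_def using assms(4)
    by (intro divide_left_mono mult_pos_pos) (auto intro: less_le_trans[of 0 "cmod (monom_val n \<alpha> w)"])
  then show ?thesis
    using mult_right_mono[of "c_coeff r s n \<alpha>" _ "cmod (monom_val n \<alpha> z)"] by force
qed

lemma card_support_multi_idx:
  assumes "\<alpha> \<in> multi_idx n m"
  shows "card {k. k < n \<and> 0 < \<alpha> k} \<le> m"
proof -
  have "card {k. k < n \<and> 0 < \<alpha> k} = (\<Sum>k\<in>{k. k < n \<and> 0 < \<alpha> k}. 1)" by simp
  also have "\<dots> \<le> (\<Sum>k\<in>{k. k < n \<and> 0 < \<alpha> k}. \<alpha> k)" by (intro sum_mono) auto
  also have "\<dots> \<le> (\<Sum>k<n. \<alpha> k)" by (intro sum_mono2) auto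
  finally show ?thesis using assms by (simp add: multi_idx_def)
qed

text \<open>Raising the at most \<open>m\<close> support coordinates to the level
  \<open>m powr (-1/r)\<close> adds only a constant: wherever sorting puts them, their total weight
  is at most \<open>(1 + r/s) * m powr (s/r)\<close>, which cancels the level's \<open>s\<close>-th
  power.\<close>

lemma lorentz_sum_max_support:
  assumes "1 \<le> s" "s \<le> r" "1 \<le> m" "\<alpha> \<in> multi_idx n m" "\<gamma> \<ge> 0"
    and w: "\<And>k. k < n \<Longrightarrow>
      cmod (w k) = \<gamma> * max (cmod (z k)) (if 0 < \<alpha> k then real m powr (- 1/r) else 0)"
  shows "lorentz_sum r s n w \<le> \<gamma> powr s * (lorentz_sum r s n z + (1 + r/s))"
proof -
  obtain p where p: "p permutes {..<n}" "\<And>k. k < n \<Longrightarrow> decr_rearr n w ! k = cmod (w (p k))"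
    using decr_rearr_permutation by blast
  let ?S = "{k. k < n \<and> 0 < \<alpha> k}"
  let ?\<omega> = "\<lambda>k. real (Suc k) powr (s/r - 1)"
  \<comment> \<open>\<open>B\<close> collects the positions taken by the support of
    \<open>\<alpha>\<close> when \<open>w\<close> is sorted.\<close>
  define B where "B = {k. k < n \<and> 0 < \<alpha> (p k)}"
  have pk: "p k < n" if "k < n" for k using permutes_in_image[OF p(1), of k] that by simp
  have "card B = card (p ` B)"
    using permutes_inj_on[OF p(1)] by (simp add: card_image)
  also have "\<dots> \<le> card ?S" by (intro card_mono) (auto simp: B_def pk)
  finally have B: "card B \<le> m" "finite B"
    using card_support_multi_idx[OF assms(4)] by (auto simp: B_def)
  have "lorentz_sum r s n w = (\<Sum>k<n. cmod (w (p k)) powr s * ?\<omega> k)"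
    unfolding lorentz_sum_def by (intro sum.cong) (auto simp: p(2))
  also have "\<dots> \<le> (\<Sum>k<n. \<gamma> powr s * (cmod (z (p k)) powr s * ?\<omega> k
                    + (if k \<in> B then real m powr (- s/r) * ?\<omega> k else 0)))"
  proof (rule sum_mono)
    fix k assume "k \<in> {..<n}"
    then have k: "k < n" by simp
    have "max a b powr s \<le> a powr s + b powr s" if "0 \<le> a" "0 \<le> b" for a b :: real
      by (simp add: max_def)
    then have "cmod (w (p k)) powr s \<le> \<gamma> powr s * (cmod (z (p k)) powr s
        + (if 0 < \<alpha> (p k) then real m powr (- 1/r) else 0) powr s)"
      unfolding w[OF pk[OF k]] using assms(5)
      by (simp add: powr_mult mult_left_mono del: max_def)
    also have "(if 0 < \<alpha> (p k) then real m powr (- 1/r) else 0) powr s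
        = (if k \<in> B then real m powr (- s/r) else 0)"
      using k by (simp add: B_def powr_powr)
    finally have "cmod (w (p k)) powr s * ?\<omega> k \<le> \<gamma> powr s * (cmod (z (p k)) powr s
        + (if k \<in> B then real m powr (- s/r) else 0)) * ?\<omega> k"
      by (intro mult_right_mono) auto
    then show "cmod (w (p k)) powr s * ?\<omega> k \<le> \<gamma> powr s * (cmod (z (p k)) powr s * ?\<omega> k
                    + (if k \<in> B then real m powr (- s/r) * ?\<omega> k else 0))"
      by (simp add: algebra_simps split: if_splits)
  qed
  also have "\<dots> = \<gamma> powr s * ((\<Sum>k<n. cmod (z (p k)) powr s * ?\<omega> k)
      + real m powr (- s/r) * (\<Sum>k\<in>B. ?\<omega> k))"
  proof -
    have "{..<n} \<inter> B = B" by (auto simp: B_def)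
    then show ?thesis
      by (simp add: sum_distrib_left[symmetric] sum.distrib sum.inter_restrict[symmetric])
  qed
  also have "\<dots> \<le> \<gamma> powr s * (lorentz_sum r s n z + (1 + r/s))"
  proof (intro mult_left_mono add_mono)
    show "(\<Sum>k<n. cmod (z (p k)) powr s * ?\<omega> k) \<le> lorentz_sum r s n z"
      using assms p by (intro permuted_sum_le_lorentz_sum) auto
    have "real m powr (- s/r) * (\<Sum>k\<in>B. ?\<omega> k)
        \<le> real m powr (- s/r) * ((1 + 1/(s/r)) * real m powr (s/r))"
      using assms B by (intro mult_left_mono sum_weights_subset_le) auto
    also have "\<dots> = 1 + r/s"
      using assms by (simp add: powr_minus)
    finally show "real m powr (- s/r) * (\<Sum>k\<in>B. ?\<omega> k) \<le> 1 + r/s" .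
  qed auto
  finally show ?thesis .
qed

lemma c_coeff_monom_le:
  assumes "1 \<le> s" "s \<le> r" "1 \<le> m" "\<alpha> \<in> multi_idx n m" "z \<in> lorentz_ball r s n"
  shows "c_coeff r s n \<alpha> * cmod (monom_val n \<alpha> z)
    \<le> ((2 + r/s) powr (1/s)) ^ m * (\<Prod>k<n. min 1 (real m powr (1/r) * cmod (z k)) ^ \<alpha> k)"
proof -
  \<comment> \<open>Chosen so that \<open>A powr s = 1 + (1 + r/s)\<close>, the bound for the
    unscaled test vector; division by \<open>A\<close> brings it into the ball.\<close>
  define A where "A = (2 + r/s) powr (1/s)"
  define b where "b = real m powr (- 1/r)"
  have rs: "2 + r/s > 0" using assms by (simp add: add_pos_pos)
  then have A: "A > 0" by (simp add: A_def)
  have b: "b > 0" using assms by (simp add: b_def)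
  \<comment> \<open>Positive on the support even where \<open>z\<close> vanishes, so the monomial at
    \<open>w\<close> is nonzero. Off the support \<open>M\<close> is the modulus of
    \<open>z\<close>, so \<open>w\<close> stays 0 from \<open>n\<close> on.\<close>
  define M where "M = (\<lambda>k. max (cmod (z k)) (if 0 < \<alpha> k then b else 0))"
  define w :: "nat \<Rightarrow> complex" where "w = (\<lambda>k. of_real (1/A * M k))"
  have M0: "0 \<le> M k" for k by (simp add: M_def le_max_iff_disj)
  have Mpos: "0 < M k" if "0 < \<alpha> k" for k using that b by (simp add: M_def less_max_iff_disj)
  have cw: "cmod (w k) = 1/A * M k" for k
    unfolding w_def norm_of_real using M0[of k] A by simp
  have z: "lorentz_sum r s n z < 1"
    using assms(5) lorentz_norm_less_1_iff[OF assms(1)] by (simp add: lorentz_ball_def)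
  have "lorentz_sum r s n w \<le> (1/A) powr s * (lorentz_sum r s n z + (1 + r/s))"
    using A by (intro lorentz_sum_max_support[OF assms(1-4)]) (auto simp: cw M_def b_def)
  also have "\<dots> < (1/A) powr s * (1 + (1 + r/s))"
    using z A by (intro mult_strict_left_mono) auto
  also have "\<dots> = 1"
  proof -
    have "A powr s = 2 + r/s" using assms rs by (simp add: A_def powr_powr)
    then show ?thesis using A rs by (simp add: powr_divide)
  qed
  finally have "lorentz_norm r s n w < 1"
    using lorentz_norm_less_1_iff[OF assms(1)] by simp
  moreover have "w k = 0" if "k \<ge> n" for k
    using that assms(4,5) by (simp add: w_def M_def multi_idx_def lorentz_ball_def)
  ultimately have wb: "w \<in> lorentz_ball r s n" by (simp add: lorentz_ball_def)
  have wnz: "monom_val n \<alpha> w \<noteq> 0"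
  proof -
    have "w k ^ \<alpha> k \<noteq> 0" for k
      using Mpos[of k] A by (cases "\<alpha> k = 0") (auto simp: w_def)
    then show ?thesis by (simp add: monom_val_def)
  qed
  have "cmod (monom_val n \<alpha> z) / cmod (monom_val n \<alpha> w) = (\<Prod>k<n. (cmod (z k) / cmod (w k)) ^ \<alpha> k)"
    by (simp add: monom_val_def prod_norm[symmetric] norm_power prod_dividef power_divide)
  also have "\<dots> = (\<Prod>k<n. A ^ \<alpha> k * min 1 (real m powr (1/r) * cmod (z k)) ^ \<alpha> k)"
  proof (rule prod.cong)
    fix k
    show "(cmod (z k) / cmod (w k)) ^ \<alpha> k = A ^ \<alpha> k * min 1 (real m powr (1/r) * cmod (z k)) ^ \<alpha> k"
    \<comment> \<open>Off the support \<open>M k\<close> may be 0, but then both powers have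
      exponent 0.\<close>
    proof (cases "\<alpha> k = 0")
      case False
      have b': "real m powr (1/r) = 1/b"
        using assms by (simp add: b_def powr_minus field_simps)
      have "cmod (z k) / M k = min 1 (cmod (z k) / b)"
        using False b by (auto simp: M_def max_def min_def field_simps)
      moreover have "cmod (z k) / cmod (w k) = A * (cmod (z k) / M k)"
        using A by (simp add: cw)
      ultimately have "cmod (z k) / cmod (w k) = A * min 1 (real m powr (1/r) * cmod (z k))"
        by (simp add: b')
      then show ?thesis by (simp only: power_mult_distrib)
    qed simp
  qed simp
  also have "\<dots> = A ^ m * (\<Prod>k<n. min 1 (real m powr (1/r) * cmod (z k)) ^ \<alpha> k)"
    using assms(4) by (simp add: prod.distrib power_sum[symmetric] multi_idx_def)
  finally show ?thesis
    using c_coeff_times_monom_le[OF wb assms(1,2) wnz, of z] by (simp add: A_def)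
qed

section \<open>Combining the estimates\<close>

lemma poly_proj_const_le:
  assumes "1 \<le> s" "s \<le> r" "1 \<le> m" "m \<le> n"
  shows "poly_proj_const r s n m
    \<le> (2 * exp 2 * (2 + r/s) powr (1/s)) ^ m * (real n / real m) powr (real m * (1 - 1/r))"
proof -
  define A where "A = (2 + r/s) powr (1/s)"
  define L where "L = (real n / real m) powr (1 - 1/r)"
  \<comment> \<open>This makes \<open>t = 1 / (2 * L)\<close> admissible in
    \<open>sum_multi_idx_le\<close>.\<close>
  have L: "1 \<le> L" unfolding L_def using assms by (intro ge_one_powr_ge_zero) auto
  have "(\<lambda>_. 0) \<in> lorentz_ball r s n"
  proof -
    have "lorentz_sum r s n (\<lambda>_. 0) = 0"
    proof -
      obtain p where "\<And>k. k < n \<Longrightarrow> decr_rearr n (\<lambda>_. 0) ! k = cmod ((\<lambda>_. 0) (p k))"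
        using decr_rearr_permutation[of n "\<lambda>_. 0"] by metis
      then show ?thesis by (simp add: lorentz_sum_def)
    qed
    then show ?thesis
      using lorentz_norm_less_1_iff[OF assms(1)] by (simp add: lorentz_ball_def)
  qed
  then have ne: "lorentz_ball r s n \<noteq> {}" by blast
  have "poly_proj_const r s n m \<le> A ^ m * (exp (2 * real m) * (2 * L) ^ m)"
    unfolding poly_proj_const_def
  proof (rule cSUP_least[OF ne])
    fix z assume z: "z \<in> lorentz_ball r s n"
    define y where "y = (\<lambda>k. min 1 (real m powr (1/r) * cmod (z k)))"
    have "lorentz_sum r s n z < 1"
      using z lorentz_norm_less_1_iff[OF assms(1)] by (simp add: lorentz_ball_def)
    then have "(\<Sum>k<n. cmod (z k)) \<le> 2 * real n powr (1 - 1/r)"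
      by (rule sum_cmod_le[OF assms(1,2)])
    then have "real m powr (1/r) * (\<Sum>k<n. cmod (z k)) \<le> real m powr (1/r) * (2 * real n powr (1 - 1/r))"
      by (intro mult_left_mono) auto
    also have "\<dots> = 2 * real m * L"
    proof -
      have "real m powr (1/r) * real m powr (1 - 1/r) = real m"
        using assms by (simp add: powr_add[symmetric])
      then have "real m powr (1/r) = real m / real m powr (1 - 1/r)"
        using assms by (simp add: eq_divide_eq)
      then show ?thesis by (simp add: L_def powr_divide)
    qed
    finally have "(\<Sum>k<n. y k) \<le> 2 * real m * L"
      using sum_mono[of "{..<n}" y "\<lambda>k. real m powr (1/r) * cmod (z k)"]
      by (simp add: y_def sum_distrib_left)
    then have "2 * (1 / (2 * L)) * (\<Sum>k<n. y k) \<le> 2 * real m"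
      using L by (simp add: field_simps)
    then have e: "exp (2 * (1 / (2 * L)) * (\<Sum>k<n. y k)) \<le> exp (2 * real m)"
      by simp
    have "(\<Sum>\<alpha>\<in>multi_idx n m. c_coeff r s n \<alpha> * cmod (monom_val n \<alpha> z))
        \<le> A ^ m * (\<Sum>\<alpha>\<in>multi_idx n m. \<Prod>k<n. y k ^ \<alpha> k)"
      unfolding sum_distrib_left y_def A_def
      using assms z by (intro sum_mono c_coeff_monom_le) auto
    \<comment> \<open>With \<open>t = 1 / (2 * L)\<close> the exponent is at most
      \<open>2 * m\<close>, and \<open>1 / t ^ m\<close> becomes \<open>(2 * L) ^ m\<close>.\<close>
    also have "\<dots> \<le> A ^ m * (exp (2 * (1 / (2 * L)) * (\<Sum>k<n. y k)) / (1 / (2 * L)) ^ m)"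
      using L by (intro mult_left_mono sum_multi_idx_le) (auto simp: y_def A_def field_simps)
    also have "\<dots> \<le> A ^ m * (exp (2 * real m) / (1 / (2 * L)) ^ m)"
      using L e by (intro mult_left_mono divide_right_mono) (auto simp: A_def)
    also have "\<dots> = A ^ m * (exp (2 * real m) * (2 * L) ^ m)"
      by (simp add: power_one_over)
    finally show "(\<Sum>\<alpha>\<in>multi_idx n m. c_coeff r s n \<alpha> * cmod (monom_val n \<alpha> z))
        \<le> A ^ m * (exp (2 * real m) * (2 * L) ^ m)" .
  qed
  also have "exp (2 * real m) = exp 2 ^ m"
    by (metis exp_of_nat_mult mult.commute)
  also have "A ^ m * (exp 2 ^ m * (2 * L) ^ m) = (2 * exp 2 * A) ^ m * L ^ m"
    by (simp add: power_mult_distrib)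
  also have "L ^ m = (real n / real m) powr (real m * (1 - 1/r))"
    using assms by (simp add: L_def powr_realpow[symmetric] powr_powr mult.commute)
  finally show ?thesis by (simp add: A_def)
qed

theorem theorem3p9:
  fixes r s :: real
  assumes "1 \<le> s" "s \<le> r" "r \<le> 2"
  shows "\<exists>C>0. \<forall>\<kappa>::real. 0 < \<kappa> \<and> \<kappa> < 1 \<longrightarrow>
           (\<forall>n m :: nat. 1 \<le> m \<and> m \<le> n \<longrightarrow>
              poly_proj_const r s n m
                \<le> C ^ m * (real n / real m) powr (real m * (1 - 1/r))
                  * max 1 (ln (real m) powr (real m * (1/s - 1/r))
                           / real n powr (real m powr \<kappa> * (1 - 1/r) / 2)))"
proof (intro exI conjI allI impI)
  have "2 + r/s > 0" using assms by (simp add: add_pos_pos)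
  \<comment> \<open>The factor \<open>2 * exp 2\<close> comes from the generating function at
    \<open>t = 1 / (2 * L)\<close>, the last factor from scaling the test vector. The constant is
    fixed before \<open>\<kappa>\<close>, \<open>n\<close> and \<open>m\<close>.\<close>
  then show C: "0 < 2 * exp 2 * (2 + r/s) powr (1/s)" by simp
  fix \<kappa> :: real and n m :: nat
  assume "1 \<le> m \<and> m \<le> n"
  then have "poly_proj_const r s n m
    \<le> (2 * exp 2 * (2 + r/s) powr (1/s)) ^ m * (real n / real m) powr (real m * (1 - 1/r)) * 1"
    using poly_proj_const_le[OF assms(1,2), of m n] by simp
  also have "(2 * exp 2 * (2 + r/s) powr (1/s)) ^ m * (real n / real m) powr (real m * (1 - 1/r)) * 1 \<le>
      (2 * exp 2 * (2 + r/s) powr (1/s)) ^ m * (real n / real m) powr (real m * (1 - 1/r))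
      * max 1 (ln (real m) powr (real m * (1/s - 1/r))
               / real n powr (real m powr \<kappa> * (1 - 1/r) / 2))"
    using C by (intro mult_left_mono mult_nonneg_nonneg zero_le_power) auto
  finally show "poly_proj_const r s n m
    \<le> (2 * exp 2 * (2 + r/s) powr (1/s)) ^ m * (real n / real m) powr (real m * (1 - 1/r))
      * max 1 (ln (real m) powr (real m * (1/s - 1/r))
               / real n powr (real m powr \<kappa> * (1 - 1/r) / 2))" .
qed

end
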